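(* Let $K$ be a $d$-dimensional simplicial complex such that for every rooted forest $(F,R)$ of $K$, $F$ simplicially collapses to $R$. Let $m=|K_d|$, $n=|K_{d-1}|$. Then $$\det(\Delta_d+\lambda I)=\sum_{i=0}^{n}|\mathcal{M}_{m-i}(K)|\,\lambda^{n-i},$$ where $\mathcal{M}_k(K)=\emptyset$ for $k<0$.
   Context: A simplicial complex $K$ is a finite family of finite sets closed under subsets; $K_p$ is the set of $p$-cells (elements of size $p+1$), $K_{\le p}$ the $p$-skeleton. The incidence matrix $\partial_d$ has rows indexed by $K_{d-1}$, columns by $K_d$, entry $(-1)^j$ at $(r,f)$ if $f=\{v_0<\dots<v_d\}$, $r=f\setminus\{v_j\}$, and $0$ otherwise; $\Delta_d=\partial_d\partial_d^T$ and $I$ is the $|K_{d-1}|\times|K_{d-1}|$ identity. For $F\subseteq K_d$, $R\subseteq K_{d-1}$, $\bar R=K_{d-1}\setminus R$, $(F,R)$ is a rooted forest of $K$ if the columns of $\partial_d$ indexed by $F$ are independent and the rows indexed by $\bar R$ of the submatrix with columns $F$ form a basis of its row space. "$F$ simplicially collapses to $R$" means $K_{\le d-1}\cup F$ can be reduced to $K_{\le d-2}\cup R$ by a finite sequence of elementary collapses, each removing a $d$-cell $\tau$ together with a $(d-1)$-face $\sigma$ of $\tau$ that is a face of no other cell of the current complex. A discrete Morse function is $f:K\to\mathbb{R}$ such that each $p$-cell $\sigma$ has at most one $(p-1)$-face $\tau$ with $f(\tau)\ge f(\sigma)$ and at most one $(p+1)$-coface $\tau$ with $f(\tau)\le f(\sigma)$;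 $\sigma$ is critical if there are none; $c_p(f)$ counts critical $p$-cells. $\mathcal{M}(K)$ is the set of discrete Morse functions modulo equality of gradients $V_f=\{(\sigma,\tau):\sigma\text{ a codim-one face of }\tau,\ f(\tau)\le f(\sigma)\}$; $\mathcal{M}_\ell(K)=\{f: c_d(f)=\ell,\ c_p(f)=|K_p|\ \forall p<d-1\}$. *)

theory Defs
  imports Complex_Main "HOL-Library.FuncSet" "Jordan_Normal_Form.Determinant"
    "Jordan_Normal_Form.VS_Connect"
begin

text \<open>
  As a complex is closed under subsets, the empty set is a cell, of dimension -1. Dimensions
  are therefore integers, and all notions below treat the empty set like any other cell.
\<close>

definition simplicial_complex :: "'a set set \<Rightarrow> bool" where
  "simplicial_complex K \<longleftrightarrow>
     finite K \<and> (\<forall>\<sigma>\<in>K. finite \<sigma>) \<and> (\<forall>\<sigma>\<in>K. \<forall>\<rho>. \<rho> \<subseteq> \<sigma> \<longrightarrow> \<rho> \<in> K)"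

definition cells :: "'a set set \<Rightarrow> int \<Rightarrow> 'a set set" where
  "cells K p = {\<sigma>\<in>K. int (card \<sigma>) = p + 1}"

definition skeleton :: "'a set set \<Rightarrow> int \<Rightarrow> 'a set set" where
  "skeleton K p = {\<sigma>\<in>K. int (card \<sigma>) \<le> p + 1}"

definition has_dimension :: "'a set set \<Rightarrow> int \<Rightarrow> bool" where
  "has_dimension K d \<longleftrightarrow> cells K d \<noteq> {} \<and> K = skeleton K d"

text \<open>Codimension-one face.\<close>

definition facet :: "'a set \<Rightarrow> 'a set \<Rightarrow> bool" where
  "facet \<sigma> \<tau> \<longleftrightarrow> \<sigma> \<subseteq> \<tau> \<and> card \<tau> = card \<sigma> + 1"


subsection \<open>Incidence matrices and rooted forests\<close>

text \<open>At most one summand is nonzero; \<open>sorted_list_of_set f ! j\<close> is the vertex $v_j$.\<close>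

definition incidence :: "'a::linorder set \<Rightarrow> 'a set \<Rightarrow> real" where
  "incidence r f =
     (\<Sum>j<card f. if r = f - {sorted_list_of_set f ! j} then (-1) ^ j else 0)"

text \<open>
  Matrices of the library are indexed by natural numbers, so finite sets of cells are listed in
  an arbitrary fixed order. Nothing below depends on the choice.
\<close>

definition enum_cells :: "'a set set \<Rightarrow> 'a set list" where
  "enum_cells S = (SOME xs. distinct xs \<and> set xs = S)"

definition incidence_mat :: "'a::linorder set set \<Rightarrow> 'a set set \<Rightarrow> real mat" where
  "incidence_mat S F =
     mat (card S) (card F) (\<lambda>(i, j). incidence (enum_cells S ! i) (enum_cells F ! j))"

definition boundary_mat :: "'a::linorder set set \<Rightarrow> int \<Rightarrow> real mat" where
  "boundary_mat K d = incidence_mat (cells K (d - 1)) (cells K d)"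

definition laplacian :: "'a::linorder set set \<Rightarrow> int \<Rightarrow> real mat" where
  "laplacian K d = boundary_mat K d * (boundary_mat K d)\<^sup>T"

text \<open>Linear independence of a list of vectors as a family: repetitions are dependent.\<close>

definition indep_list :: "nat \<Rightarrow> real vec list \<Rightarrow> bool" where
  "indep_list n vs \<longleftrightarrow>
     distinct vs \<and> \<not> module.lin_dep class_ring (module_vec TYPE(real) n) (set vs)"

definition rooted_forest ::
    "'a::linorder set set \<Rightarrow> int \<Rightarrow> 'a set set \<Rightarrow> 'a set set \<Rightarrow> bool" where
  "rooted_forest K d F R \<longleftrightarrow>
     F \<subseteq> cells K d \<and> R \<subseteq> cells K (d - 1) \<and>
     (let A = incidence_mat (cells K (d - 1)) F;
          B = incidence_mat (cells K (d - 1) - R) F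
      in indep_list (dim_row A) (cols A) \<and>
         indep_list (dim_col A) (rows B) \<and>
         vec_space.row_space (dim_col A) B = vec_space.row_space (dim_col A) A)"


subsection \<open>Collapses\<close>

definition elementary_collapse :: "int \<Rightarrow> 'a set set \<Rightarrow> 'a set set \<Rightarrow> bool" where
  "elementary_collapse d L L' \<longleftrightarrow>
     (\<exists>\<tau>\<in>cells L d. \<exists>\<sigma>\<in>cells L (d - 1).
        \<sigma> \<subseteq> \<tau> \<and> (\<forall>\<rho>\<in>L. \<sigma> \<subset> \<rho> \<longrightarrow> \<rho> = \<tau>) \<and> L' = L - {\<sigma>, \<tau>})"

definition simplicially_collapses ::
    "'a set set \<Rightarrow> int \<Rightarrow> 'a set set \<Rightarrow> 'a set set \<Rightarrow> bool" where
  "simplicially_collapses K d F R \<longleftrightarrow>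
     (elementary_collapse d)\<^sup>*\<^sup>* (skeleton K (d - 1) \<union> F) (skeleton K (d - 2) \<union> R)"


subsection \<open>Discrete Morse functions\<close>

definition face_exceptions :: "'a set set \<Rightarrow> ('a set \<Rightarrow> real) \<Rightarrow> 'a set \<Rightarrow> 'a set set" where
  "face_exceptions K f \<sigma> = {\<tau>\<in>K. facet \<tau> \<sigma> \<and> f \<tau> \<ge> f \<sigma>}"

definition coface_exceptions :: "'a set set \<Rightarrow> ('a set \<Rightarrow> real) \<Rightarrow> 'a set \<Rightarrow> 'a set set" where
  "coface_exceptions K f \<sigma> = {\<tau>\<in>K. facet \<sigma> \<tau> \<and> f \<tau> \<le> f \<sigma>}"

definition morse_functions :: "'a set set \<Rightarrow> ('a set \<Rightarrow> real) set" where
  "morse_functions K =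
     {f \<in> K \<rightarrow>\<^sub>E UNIV. \<forall>\<sigma>\<in>K.
        card (face_exceptions K f \<sigma>) \<le> 1 \<and> card (coface_exceptions K f \<sigma>) \<le> 1}"

definition critical_cells :: "'a set set \<Rightarrow> ('a set \<Rightarrow> real) \<Rightarrow> int \<Rightarrow> 'a set set" where
  "critical_cells K f p =
     {\<sigma>\<in>cells K p. face_exceptions K f \<sigma> = {} \<and> coface_exceptions K f \<sigma> = {}}"

definition gradient :: "'a set set \<Rightarrow> ('a set \<Rightarrow> real) \<Rightarrow> ('a set \<times> 'a set) set" where
  "gradient K f = {(\<sigma>, \<tau>). \<sigma> \<in> K \<and> \<tau> \<in> K \<and> facet \<sigma> \<tau> \<and> f \<tau> \<le> f \<sigma>}"

definition gradient_equiv :: "'a set set \<Rightarrow> (('a set \<Rightarrow> real) \<times> ('a set \<Rightarrow> real)) set" where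
  "gradient_equiv K =
     {(f, g). f \<in> morse_functions K \<and> g \<in> morse_functions K \<and> gradient K f = gradient K g}"

text \<open>
  The set $\mathcal{M}_\ell(K)$ for a $d$-dimensional \<open>K\<close>. Its defining conditions on the
  critical cells of \<open>f\<close> depend only on the gradient of \<open>f\<close>, so it is a set of full classes.
\<close>

definition morse_classes :: "'a set set \<Rightarrow> int \<Rightarrow> int \<Rightarrow> ('a set \<Rightarrow> real) set set" where
  "morse_classes K d l =
     {f \<in> morse_functions K.
        int (card (critical_cells K f d)) = l \<and>
        (\<forall>p<d - 1. card (critical_cells K f p) = card (cells K p))} // gradient_equiv K"

end

theory Submission
  imports Defs "Jordan_Normal_Form.DL_Rank"
begin

text \<open>
  Expanding the determinant and applying Binet--Cauchy, the coefficient of $\lambda^{n-i}$ is the sum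
  of $\det(\partial_{S,F})^2$ over the sets $S$ of $(d-1)$-cells and $F$ of $d$-cells of size $i$.
  If the minor is nonzero, $F$ is a rooted forest with root set the complement of $S$, hence it
  collapses, and the pairs removed by the collapse form an acyclic matching of $S$ with $F$.
  Conversely, acyclicity of a matching makes the minor triangular, so that the only nonzero term of
  its expansion is $\pm 1$ and the matching is determined by $(S, F)$. Finally, acyclic matchings
  of $(d-1)$-cells with $d$-cells are exactly the gradients of the discrete Morse functions that
  are critical on all cells of dimension below $d-1$, a matching of size $i$ leaving $m-i$
  critical $d$-cells.
\<close>

subsection \<open>Binet--Cauchy\<close>

text \<open>The Leibniz formula with rows and columns indexed by the set itself, so that passing to
  a principal submatrix just means shrinking \<open>A\<close> and the enumerations of cells stay out
  of the expansion.\<close>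

definition perm_det :: "'i set \<Rightarrow> ('i \<Rightarrow> 'i \<Rightarrow> real) \<Rightarrow> real" where
  "perm_det A a = (\<Sum>p | p permutes A. of_int (sign p) * (\<Prod>i\<in>A. a i (p i)))"

text \<open>Conjugation by \<open>e\<close> carries permutations of indices to permutations of
  \<open>A\<close> and preserves signs, so the two Leibniz sums agree term by term.\<close>

lemma det_eq_perm_det:
  assumes e: "bij_betw e {0..<n} A"
  shows "det (mat n n (\<lambda>(i, j). a (e i) (e j))) = perm_det A a"
proof -
  let ?N = "{0..<n}"
  have inj: "inj_on e ?N" and im: "e ` ?N = A" using e by (auto simp: bij_betw_def)
  let ?c = "\<lambda>p x. if x \<in> A then e (p (inv_into ?N e x)) else x"
  have c: "?c p = map_permutation ?N e p" for p
    unfolding map_permutation_def im by (auto simp: restrict_id_def fun_eq_iff)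
  have "perm_det A a
      = (\<Sum>p | p permutes ?N. of_int (sign (?c p)) * (\<Prod>x\<in>A. a x (?c p x)))"
    unfolding perm_det_def by (rule sum.reindex_bij_betw[OF bij_betw_permutations[OF e], symmetric])
  also have "\<dots> = (\<Sum>p | p permutes ?N. of_int (sign p) *
      (\<Prod>i\<in>?N. mat n n (\<lambda>(i, j). a (e i) (e j)) $$ (i, p i)))"
  proof (intro sum.cong refl arg_cong2[where f = "(*)"])
    fix p assume "p \<in> {p. p permutes ?N}"
    then have p: "p permutes ?N" by simp
    show "of_int (sign (?c p)) = real_of_int (sign p)"
      unfolding c using sign_map_permutation[OF inj p] by simp
    have "(\<Prod>x\<in>A. a x (?c p x)) = (\<Prod>i\<in>?N. a (e i) (?c p (e i)))"
      by (rule prod.reindex_bij_betw[OF e, symmetric])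
    also have "\<dots> = (\<Prod>i\<in>?N. mat n n (\<lambda>(i, j). a (e i) (e j)) $$ (i, p i))"
    proof (rule prod.cong[OF refl])
      fix i assume i: "i \<in> ?N"
      then have "p i \<in> ?N" by (simp only: permutes_in_image[OF p])
      with i show "a (e i) (?c p (e i)) = mat n n (\<lambda>(i, j). a (e i) (e j)) $$ (i, p i)"
        using im inv_into_f_f[OF inj i] by auto
    qed
    finally show "(\<Prod>x\<in>A. a x (?c p x))
      = (\<Prod>i\<in>?N. mat n n (\<lambda>(i, j). a (e i) (e j)) $$ (i, p i))" .
  qed
  also have "\<dots> = det (mat n n (\<lambda>(i, j). a (e i) (e j)))"
    by (rule det_def'[symmetric]) simp
  finally show ?thesis by simp
qed

text \<open>Transposed submatrix with rows \<open>S\<close>, in which column \<open>f i\<close> of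
  \<open>M\<close> stands at position \<open>i\<close>. \<open>f\<close> need not be injective,
  because expanding a Gram determinant produces all choices of columns.\<close>

definition minor :: "('i \<Rightarrow> 'k \<Rightarrow> real) \<Rightarrow> 'i set \<Rightarrow> ('i \<Rightarrow> 'k) \<Rightarrow> real" where
  "minor M S f = perm_det S (\<lambda>i j. M j (f i))"

text \<open>Substitute \<open>p \<circ> q\<close> for \<open>p\<close> in the Leibniz sum and
  reindex each product along \<open>q\<close>; the sign of \<open>q\<close> splits off.\<close>

lemma minor_permute:
  assumes "finite S" and q: "q permutes S"
  shows "minor M S (\<lambda>i. f (q i)) = of_int (sign q) * minor M S f"
proof -
  have "minor M S (\<lambda>i. f (q i)) =
      (\<Sum>p | p permutes S. of_int (sign (p \<circ> q)) * (\<Prod>i\<in>S. M ((p \<circ> q) i) (f (q i))))"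
    unfolding minor_def perm_det_def
    by (rule sum_permutations_compose_right[OF q])
  also have "\<dots> = (\<Sum>p | p permutes S. of_int (sign q) * (of_int (sign p) * (\<Prod>i\<in>S. M (p i) (f i))))"
  proof (rule sum.cong[OF refl])
    fix p assume "p \<in> {p. p permutes S}"
    then have p: "p permutes S" by simp
    have "sign (p \<circ> q) = sign p * sign q"
      using p q \<open>finite S\<close> by (intro sign_compose) (auto simp: permutation_permutes)
    moreover have "(\<Prod>i\<in>S. M ((p \<circ> q) i) (f (q i))) = (\<Prod>i\<in>S. M (p i) (f i))"
      using prod.reindex_bij_betw[OF permutes_imp_bij[OF q], of "\<lambda>i. M (p i) (f i)"] by simp
    ultimately show "real_of_int (sign (p \<circ> q)) * (\<Prod>i\<in>S. M ((p \<circ> q) i) (f (q i))) =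
        of_int (sign q) * (of_int (sign p) * (\<Prod>i\<in>S. M (p i) (f i)))"
      by simp
  qed
  finally show ?thesis by (simp add: minor_def perm_det_def sum_distrib_left)
qed

text \<open>Swapping the positions of two equal columns leaves \<open>f\<close> unchanged but
  negates the minor.\<close>

lemma minor_not_inj:
  assumes "finite S" and "\<not> inj_on f S"
  shows "minor M S f = 0"
proof -
  obtain a b where ab: "a \<in> S" "b \<in> S" "a \<noteq> b" "f a = f b"
    using assms(2) by (auto simp: inj_on_def)
  have "(\<lambda>i. f (transpose a b i)) = f"
    using ab by (auto simp: transpose_def fun_eq_iff)
  with minor_permute[OF \<open>finite S\<close> permutes_swap_id[OF ab(1,2)], of M f] ab
  show ?thesis by (simp add: sign_swap_id)
qed

text \<open>Bijections onto a fixed column set differ by a permutation of the rows.\<close>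

lemma sum_bij_minor:
  assumes S: "finite S" and f0: "bij_betw f0 S F"
  shows "(\<Sum>f | f \<in> S \<rightarrow>\<^sub>E F \<and> bij_betw f S F. (\<Prod>i\<in>S. M i (f i)) * minor M S f) = (minor M S f0)\<^sup>2"
proof -
  let ?B = "{f. f \<in> S \<rightarrow>\<^sub>E F \<and> bij_betw f S F}"
  let ?g = "\<lambda>q. restrict (\<lambda>i. f0 (q i)) S"
  \<comment> \<open>Inverse of \<open>?g\<close>: the permutation comparing \<open>f\<close> with
    \<open>f0\<close>, extended by the identity outside \<open>S\<close> as \<open>permutes\<close>
    demands.\<close>
  let ?h = "\<lambda>f i. if i \<in> S then inv_into S f0 (f i) else i"
  have inj: "inj_on f0 S" and im: "f0 ` S = F" using f0 by (auto simp: bij_betw_def)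
  have bij: "bij_betw ?g {q. q permutes S} ?B"
  proof (rule bij_betw_byWitness[where f' = ?h])
    show "\<forall>q\<in>{q. q permutes S}. ?h (?g q) = q"
    proof (intro ballI ext)
      fix q i assume "q \<in> {q. q permutes S}"
      then have q: "q permutes S" by simp
      show "?h (?g q) i = q i"
        using q inv_into_f_f[OF inj] by (auto simp: permutes_in_image permutes_not_in)
    qed
    show "\<forall>f\<in>?B. ?g (?h f) = f"
    proof (intro ballI ext)
      fix f i assume f: "f \<in> ?B"
      show "?g (?h f) i = f i"
        using f im by (auto simp: PiE_iff extensional_def f_inv_into_f)
    qed
    show "?g ` {q. q permutes S} \<subseteq> ?B"
    proof (rule image_subsetI)
      fix q assume "q \<in> {q. q permutes S}"
      then have q: "q permutes S" by simp
      have 1: "?g q \<in> S \<rightarrow>\<^sub>E F" using q im by (auto simp: permutes_in_image)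
      have "bij_betw (f0 \<circ> q) S F"
        using bij_betw_trans[OF permutes_imp_bij[OF q] f0] .
      then have "bij_betw (?g q) S F"
        by (rule bij_betw_cong[THEN iffD1, rotated]) simp
      with 1 show "?g q \<in> ?B" by simp
    qed
    show "?h ` ?B \<subseteq> {q. q permutes S}"
    proof (rule image_subsetI)
      fix f assume "f \<in> ?B"
      then have f: "bij_betw f S F" by simp
      have "bij_betw (inv_into S f0 \<circ> f) S S"
        using bij_betw_trans[OF f bij_betw_inv_into[OF f0]] .
      then have "bij_betw (?h f) S S"
        by (rule bij_betw_cong[THEN iffD1, rotated]) simp
      then have "?h f permutes S" by (rule bij_imp_permutes) simp
      then show "?h f \<in> {q. q permutes S}" by simp
    qed
  qed
  have "(\<Sum>f\<in>?B. (\<Prod>i\<in>S. M i (f i)) * minor M S f)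
      = (\<Sum>q | q permutes S. (\<Prod>i\<in>S. M i (?g q i)) * minor M S (?g q))"
    by (rule sum.reindex_bij_betw[OF bij, symmetric])
  also have "\<dots> = (\<Sum>q | q permutes S. (of_int (sign q) * (\<Prod>i\<in>S. M i (f0 (q i)))) * minor M S f0)"
  proof (rule sum.cong[OF refl])
    fix q assume "q \<in> {q. q permutes S}"
    then have "q permutes S" by simp
    moreover have "minor M S (?g q) = minor M S (\<lambda>i. f0 (q i))"
      unfolding minor_def perm_det_def by simp
    ultimately show "(\<Prod>i\<in>S. M i (?g q i)) * minor M S (?g q)
        = (of_int (sign q) * (\<Prod>i\<in>S. M i (f0 (q i)))) * minor M S f0"
      using minor_permute[OF S, of q M f0] by simp
  qed
  also have "\<dots> = (\<Sum>q | q permutes S. of_int (sign q) * (\<Prod>i\<in>S. M i (f0 (q i)))) * minor M S f0"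
    by (simp add: sum_distrib_right)
  \<comment> \<open>Here the rows are fixed and the columns permuted, so this is the determinant of
    the transpose; inverting the permutations turns it into \<open>minor\<close>.\<close>
  also have "(\<Sum>q | q permutes S. of_int (sign q) * (\<Prod>i\<in>S. M i (f0 (q i)))) = minor M S f0"
  proof -
    have "(\<Sum>q | q permutes S. of_int (sign q) * (\<Prod>i\<in>S. M i (f0 (q i))))
        = (\<Sum>q | q permutes S. of_int (sign (inv_into UNIV q)) * (\<Prod>i\<in>S. M i (f0 (inv_into UNIV q i))))"
      by (rule sum_permutations_inverse)
    also have "\<dots> = minor M S f0"
      unfolding minor_def perm_det_def
    proof (rule sum.cong[OF refl])
      fix q assume "q \<in> {q. q permutes S}"
      then have q: "q permutes S" by simp
      have "(\<Prod>i\<in>S. M i (f0 (inv_into UNIV q i))) = (\<Prod>i\<in>S. M (q i) (f0 (inv_into UNIV q (q i))))"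
        by (rule prod.reindex_bij_betw[OF permutes_imp_bij[OF q], symmetric])
      then show "real_of_int (sign (inv_into UNIV q)) * (\<Prod>i\<in>S. M i (f0 (inv_into UNIV q i)))
          = of_int (sign q) * (\<Prod>i\<in>S. M (q i) (f0 i))"
        using q S by (simp add: permutes_inverses sign_inverse permutes_imp_permutation)
    qed
    finally show ?thesis .
  qed
  finally show ?thesis by (simp add: power2_eq_square)
qed

text \<open>Multiply out each product over the rows: \<open>S\<close> collects the rows whose factor
  comes from the Gram matrix, the others contribute the scalar. Multiplying out the Gram entries
  lets \<open>f\<close> choose a column for each row in \<open>S\<close>, and \<open>F\<close> is
  the image of \<open>f\<close>.\<close>

lemma perm_det_gram_plus_scalar:
  assumes A: "finite A" and C: "finite C"
  shows "perm_det A (\<lambda>i j. (\<Sum>k\<in>C. M i k * M j k) + (if i = j then lam else 0)) =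
    (\<Sum>S\<in>Pow A. \<Sum>F\<in>Pow C. lam ^ (card A - card S) *
       (\<Sum>f | f \<in> S \<rightarrow>\<^sub>E F \<and> bij_betw f S F. (\<Prod>i\<in>S. M i (f i)) * minor M S f))"
proof -
  let ?b = "\<lambda>i j. \<Sum>k\<in>C. M i k * M j k"
  let ?d = "\<lambda>i j. if i = j then lam else 0"
  let ?P = "\<lambda>S. {p. p permutes S}"
  have finP: "finite (?P S)" if "S \<subseteq> A" for S
    using finite_permutations finite_subset[OF that A] by blast
  have "perm_det A (\<lambda>i j. ?b i j + ?d i j) =
      (\<Sum>p\<in>?P A. \<Sum>S\<in>Pow A. of_int (sign p) * ((\<Prod>i\<in>S. ?b i (p i)) * (\<Prod>i\<in>A-S. ?d i (p i))))"
    unfolding perm_det_def prod_add[OF A] by (simp add: sum_distrib_left)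
  also have "\<dots> =
      (\<Sum>S\<in>Pow A. \<Sum>p\<in>?P A. of_int (sign p) * ((\<Prod>i\<in>S. ?b i (p i)) * (\<Prod>i\<in>A-S. ?d i (p i))))"
    by (rule sum.swap)
  also have "\<dots> = (\<Sum>S\<in>Pow A. \<Sum>F\<in>Pow C. lam ^ (card A - card S) *
       (\<Sum>f | f \<in> S \<rightarrow>\<^sub>E F \<and> bij_betw f S F. (\<Prod>i\<in>S. M i (f i)) * minor M S f))"
  proof (rule sum.cong[OF refl])
    fix S assume "S \<in> Pow A"
    then have SA: "S \<subseteq> A" by simp
    have S: "finite S" using SA A by (rule finite_subset)
    let ?l = "lam ^ (card A - card S)"
    let ?t = "\<lambda>f. (\<Prod>i\<in>S. M i (f i)) * minor M S f"
    \<comment> \<open>A permutation moving an element of \<open>A - S\<close> meets an off-diagonal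
      zero, so only permutations of \<open>S\<close> contribute.\<close>
    have "(\<Sum>p\<in>?P A. of_int (sign p) * ((\<Prod>i\<in>S. ?b i (p i)) * (\<Prod>i\<in>A-S. ?d i (p i))))
        = (\<Sum>p\<in>?P S. of_int (sign p) * ((\<Prod>i\<in>S. ?b i (p i)) * (\<Prod>i\<in>A-S. ?d i (p i))))"
    proof (rule sum.mono_neutral_right[OF finP[OF order_refl]])
      show "?P S \<subseteq> ?P A" using SA permutes_subset by blast
      show "\<forall>p\<in>?P A - ?P S. of_int (sign p) * ((\<Prod>i\<in>S. ?b i (p i)) * (\<Prod>i\<in>A-S. ?d i (p i))) = 0"
      proof
        fix p assume p: "p \<in> ?P A - ?P S"
        obtain i where i: "i \<in> A - S" "p i \<noteq> i"
        proof (rule ccontr)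
          assume "\<not> thesis"
          then have "p permutes S" using p that by (auto intro: permutes_superset)
          with p show False by simp
        qed
        have "(\<Prod>i\<in>A-S. ?d i (p i)) = 0"
          using A i by (intro prod_zero bexI[of _ i]) auto
        then show "of_int (sign p) * ((\<Prod>i\<in>S. ?b i (p i)) * (\<Prod>i\<in>A-S. ?d i (p i))) = 0"
          by simp
      qed
    qed
    also have "\<dots> = (\<Sum>p\<in>?P S. \<Sum>f\<in>S \<rightarrow>\<^sub>E C.
        ?l * ((\<Prod>i\<in>S. M i (f i)) * (of_int (sign p) * (\<Prod>i\<in>S. M (p i) (f i)))))"
    proof (rule sum.cong[OF refl])
      fix p assume "p \<in> ?P S"
      then have p: "p permutes S" by simp
      have "(\<Prod>i\<in>A-S. ?d i (p i)) = (\<Prod>i\<in>A-S. lam)"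
        using permutes_not_in[OF p] by (intro prod.cong) auto
      also have "\<dots> = ?l" using SA S by (simp add: card_Diff_subset)
      finally have 1: "(\<Prod>i\<in>A-S. ?d i (p i)) = ?l" .
      have 2: "(\<Prod>i\<in>S. ?b i (p i)) = (\<Sum>f\<in>S \<rightarrow>\<^sub>E C. (\<Prod>i\<in>S. M i (f i)) * (\<Prod>i\<in>S. M (p i) (f i)))"
        by (simp add: prod_sum_PiE[OF S C] prod.distrib)
      show "of_int (sign p) * ((\<Prod>i\<in>S. ?b i (p i)) * (\<Prod>i\<in>A-S. ?d i (p i))) =
        (\<Sum>f\<in>S \<rightarrow>\<^sub>E C. ?l * ((\<Prod>i\<in>S. M i (f i)) * (of_int (sign p) * (\<Prod>i\<in>S. M (p i) (f i)))))"
        unfolding 1 2 sum_distrib_left sum_distrib_right by (intro sum.cong) (auto simp: algebra_simps)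
    qed
    also have "\<dots> = (\<Sum>f\<in>S \<rightarrow>\<^sub>E C. \<Sum>p\<in>?P S.
        ?l * ((\<Prod>i\<in>S. M i (f i)) * (of_int (sign p) * (\<Prod>i\<in>S. M (p i) (f i)))))"
      by (rule sum.swap)
    also have "\<dots> = (\<Sum>f\<in>S \<rightarrow>\<^sub>E C. ?l * ?t f)"
      unfolding minor_def perm_det_def by (simp add: sum_distrib_left)
    \<comment> \<open>Non-injective choices have a vanishing minor; the injective ones are then
      grouped by their image, on which they are bijections.\<close>
    also have "\<dots> = (\<Sum>f\<in>{f\<in>S \<rightarrow>\<^sub>E C. inj_on f S}. ?l * ?t f)"
      using S C by (intro sum.mono_neutral_right) (auto simp: finite_PiE minor_not_inj)
    also have "\<dots> = (\<Sum>F\<in>Pow C. \<Sum>f\<in>{f. f \<in> {f\<in>S \<rightarrow>\<^sub>E C. inj_on f S} \<and> f ` S = F}. ?l * ?t f)"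
      using S C by (intro sum.group[symmetric]) (auto simp: finite_PiE)
    also have "\<dots> = (\<Sum>F\<in>Pow C. ?l * (\<Sum>f | f \<in> S \<rightarrow>\<^sub>E F \<and> bij_betw f S F. ?t f))"
      unfolding sum_distrib_left
      by (intro sum.cong refl) (auto simp: bij_betw_def PiE_iff)
    finally show "(\<Sum>p\<in>?P A. of_int (sign p) * ((\<Prod>i\<in>S. ?b i (p i)) * (\<Prod>i\<in>A-S. ?d i (p i))))
      = (\<Sum>F\<in>Pow C. ?l * (\<Sum>f | f \<in> S \<rightarrow>\<^sub>E F \<and> bij_betw f S F. ?t f))" .
  qed
  finally show ?thesis .
qed


subsection \<open>Incidence matrices\<close>

lemma enum_cells:
  assumes "finite S"
  shows "set (enum_cells S) = S" "length (enum_cells S) = card S"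
    and "bij_betw ((!) (enum_cells S)) {0..<card S} S"
proof -
  have *: "distinct (enum_cells S) \<and> set (enum_cells S) = S"
    unfolding enum_cells_def by (rule someI_ex) (use finite_distinct_list[OF assms] in blast)
  then show s: "set (enum_cells S) = S" and l: "length (enum_cells S) = card S"
    using distinct_card[of "enum_cells S"] by auto
  show "bij_betw ((!) (enum_cells S)) {0..<card S} S"
    using bij_betw_nth[of "enum_cells S" "{0..<card S}" S] * l by (simp add: atLeast0LessThan)
qed

lemma incidence_mat_carrier: "incidence_mat S F \<in> carrier_mat (card S) (card F)"
  by (simp add: incidence_mat_def)

lemma sum_bij_minor_incidence:
  assumes S: "finite S" and F: "finite F" and card: "card S = card F"
  shows "(\<Sum>f | f \<in> S \<rightarrow>\<^sub>E F \<and> bij_betw f S F. (\<Prod>i\<in>S. incidence i (f i)) * minor incidence S f)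
    = (det (incidence_mat S F))\<^sup>2"
proof -
  let ?k = "card F" and ?e = "(!) (enum_cells S)" and ?c = "(!) (enum_cells F)"
  have e: "bij_betw ?e {0..<?k} S" using enum_cells(3)[OF S] card by simp
  have c: "bij_betw ?c {0..<?k} F" using enum_cells(3)[OF F] .
  \<comment> \<open>\<open>f\<close> matches cells carrying the same index in the two enumerations,
    which makes \<open>minor\<close> the determinant of the transposed
    \<open>incidence_mat\<close>.\<close>
  define f where "f = ?c \<circ> inv_into {0..<?k} ?e"
  have fe: "f (?e i) = ?c i" if "i < ?k" for i
    using that inv_into_f_f[OF bij_betw_imp_inj_on[OF e]] by (simp add: f_def)
  have "bij_betw f S F"
    unfolding f_def by (rule bij_betw_trans[OF bij_betw_inv_into[OF e] c])
  moreover have "minor incidence S f = det (incidence_mat S F)"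
  proof -
    have "minor incidence S f = det (mat ?k ?k (\<lambda>(i, j). incidence (?e j) (f (?e i))))"
      unfolding minor_def by (rule det_eq_perm_det[OF e, symmetric])
    also have "mat ?k ?k (\<lambda>(i, j). incidence (?e j) (f (?e i))) = (incidence_mat S F)\<^sup>T"
      by (rule eq_matI) (auto simp: incidence_mat_def card fe)
    also have "det \<dots> = det (incidence_mat S F)"
      using incidence_mat_carrier[of S F] card by (intro det_transpose) simp
    finally show ?thesis .
  qed
  ultimately show ?thesis using sum_bij_minor[OF S, of f F incidence] by simp
qed

lemma det_laplacian_plus_scalar:
  assumes A: "finite (cells K (d - 1))" and C: "finite (cells K d)"
  shows "det (laplacian K d + lam \<cdot>\<^sub>m 1\<^sub>m (card (cells K (d - 1)))) =
    perm_det (cells K (d - 1))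
      (\<lambda>i j. (\<Sum>k\<in>cells K d. incidence i k * incidence j k) + (if i = j then lam else 0))"
proof -
  let ?A = "cells K (d - 1)" and ?C = "cells K d"
  let ?n = "card ?A" and ?e = "(!) (enum_cells ?A)" and ?c = "(!) (enum_cells ?C)"
  have e: "bij_betw ?e {0..<?n} ?A" by (rule enum_cells(3)[OF A])
  have "laplacian K d + lam \<cdot>\<^sub>m 1\<^sub>m ?n = mat ?n ?n (\<lambda>(i, j).
      (\<Sum>k\<in>?C. incidence (?e i) k * incidence (?e j) k) + (if ?e i = ?e j then lam else 0))"
    (is "_ = mat _ _ ?m")
  proof (rule eq_matI)
    fix i j assume "i < dim_row (mat ?n ?n ?m)" "j < dim_col (mat ?n ?n ?m)"
    then have ij: "i < ?n" "j < ?n" by auto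
    have "(\<Sum>k\<in>?C. incidence (?e i) k * incidence (?e j) k) =
        (\<Sum>l\<in>{0..<card ?C}. incidence (?e i) (?c l) * incidence (?e j) (?c l))"
      by (rule sum.reindex_bij_betw[OF enum_cells(3)[OF C], symmetric])
    moreover have "?e i = ?e j \<longleftrightarrow> i = j"
      using ij bij_betw_imp_inj_on[OF e] by (auto dest: inj_onD)
    ultimately show "(laplacian K d + lam \<cdot>\<^sub>m 1\<^sub>m ?n) $$ (i, j) = mat ?n ?n ?m $$ (i, j)"
      using ij by (simp add: laplacian_def boundary_mat_def incidence_mat_def scalar_prod_def)
  qed (simp_all add: laplacian_def boundary_mat_def incidence_mat_def)
  then show ?thesis using det_eq_perm_det[OF e] by simp
qed

section \<open>Rooted forests from nonsingular minors\<close>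

text \<open>A nonsingular block on the rows \<open>S\<close> settles all three conditions: a vector
  killed by all rows is killed by the block, hence zero; the rows of the block are independent; and
  they span the whole coordinate space, leaving no room for a larger row space.\<close>

lemma rooted_forestI:
  assumes X: "finite (cells K (d - 1))" and F: "F \<subseteq> cells K d" "finite F"
    and S: "S \<subseteq> cells K (d - 1)" and card: "card S = card F"
    and det: "det (incidence_mat S F) \<noteq> 0"
  shows "rooted_forest K d F (cells K (d - 1) - S)"
proof -
  let ?X = "cells K (d - 1)" and ?k = "card F"
  let ?A = "incidence_mat ?X F" and ?B = "incidence_mat S F"
  have fS: "finite S" using S X by (rule finite_subset)
  have A: "?A \<in> carrier_mat (card ?X) ?k" by (rule incidence_mat_carrier)
  have B: "?B \<in> carrier_mat ?k ?k" using incidence_mat_carrier[of S F] card by simp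
  have rows: "\<exists>i'<card ?X. row ?A i' = row ?B i" if i: "i < ?k" for i
  proof -
    have "enum_cells S ! i \<in> set (enum_cells ?X)"
      using i card S enum_cells(1,2)[OF fS] enum_cells(1)[OF X] by (metis nth_mem subsetD)
    then obtain i' where "i' < card ?X" "enum_cells ?X ! i' = enum_cells S ! i"
      unfolding in_set_conv_nth enum_cells(2)[OF X] by blast
    then show ?thesis
      using i card by (intro exI[of _ i']) (auto simp: incidence_mat_def row_def)
  qed
  have kernel: "v = 0\<^sub>v ?k" if v: "v \<in> carrier_vec ?k" "?A *\<^sub>v v = 0\<^sub>v (card ?X)" for v
  proof -
    have "?B *\<^sub>v v = 0\<^sub>v ?k"
    proof (rule eq_vecI)
      fix i assume "i < dim_vec (0\<^sub>v ?k :: real vec)"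
      then have i: "i < ?k" by simp
      with rows obtain i' where i': "i' < card ?X" "row ?A i' = row ?B i" by blast
      have "(?B *\<^sub>v v) $ i = (?A *\<^sub>v v) $ i'" using i i' A B by simp
      then show "(?B *\<^sub>v v) $ i = 0\<^sub>v ?k $ i" using i i' v by simp
    qed (use B in simp)
    with v det det_0_iff_vec_prod_zero_field[OF B] show ?thesis by blast
  qed
  \<comment> \<open>Two equal columns would put the difference of two unit vectors into the
    kernel.\<close>
  have "distinct (cols ?A)"
  proof (rule ccontr)
    assume "\<not> ?thesis"
    then obtain i j where ij: "i < ?k" "j < ?k" "i \<noteq> j" "col ?A i = col ?A j"
      using A by (auto simp: distinct_conv_nth)
    have "unit_vec ?k i - unit_vec ?k j = (0\<^sub>v ?k :: real vec)"
    proof (rule kernel)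
      show "?A *\<^sub>v (unit_vec ?k i - unit_vec ?k j) = 0\<^sub>v (card ?X)"
      proof (rule eq_vecI)
        fix l assume "l < dim_vec (0\<^sub>v (card ?X) :: real vec)"
        then have l: "l < card ?X" by simp
        have row: "row ?A l \<in> carrier_vec ?k" using A l by simp
        have "?A $$ (l, i) = ?A $$ (l, j)"
          using ij(4) l A ij by (metis carrier_matD index_col)
        then show "(?A *\<^sub>v (unit_vec ?k i - unit_vec ?k j)) $ l = 0\<^sub>v (card ?X) $ l"
          using l ij A scalar_prod_minus_distrib[OF row, of "unit_vec ?k i" "unit_vec ?k j"]
          by simp
      qed (use A in simp)
    qed simp
    then have "(unit_vec ?k i - unit_vec ?k j) $ i = (0\<^sub>v ?k :: real vec) $ i" by simp
    with ij show False by simp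
  qed
  moreover have "\<not> module.lin_dep class_ring (module_vec TYPE(real) (card ?X)) (set (cols ?A))"
  proof
    interpret vec_space "TYPE(real)" "card ?X" .
    assume "lin_dep (set (cols ?A))"
    from lin_depE[OF A this \<open>distinct (cols ?A)\<close>] kernel show False by blast
  qed
  ultimately have 1: "indep_list (dim_row ?A) (cols ?A)"
    using A by (simp add: indep_list_def)
  interpret vec_space "TYPE(real)" ?k .
  have "distinct (rows ?B)"
    using det det_identical_rows[OF B] B by (auto simp: distinct_conv_nth)
  then have 2: "indep_list (dim_col ?A) (rows ?B)"
    using A det_not_0_imp_lin_indpt_rows[OF B det] by (simp add: indep_list_def)
  \<comment> \<open>With \<open>C\<close> a right inverse of the transposed block, \<open>C\<close>
    applied to \<open>w\<close> gives the coefficients that express \<open>w\<close> through the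
    rows.\<close>
  have "row_space ?B = carrier_vec ?k"
  proof -
    have BT: "?B\<^sup>T \<in> carrier_mat ?k ?k" using B by simp
    have "det (?B\<^sup>T) \<noteq> 0" using det det_transpose[OF B] by simp
    from det_non_zero_imp_unit[OF BT this]
    obtain C where C: "C \<in> carrier_mat ?k ?k" "?B\<^sup>T * C = 1\<^sub>m ?k"
      by (auto simp: Units_def ring_mat_def)
    have "\<exists>y\<in>carrier_vec ?k. ?B\<^sup>T *\<^sub>v y = w" if w: "w \<in> carrier_vec ?k" for w
    proof
      have "?B\<^sup>T *\<^sub>v (C *\<^sub>v w) = (?B\<^sup>T * C) *\<^sub>v w"
        using assoc_mult_mat_vec[OF BT C(1) w] by simp
      then show "?B\<^sup>T *\<^sub>v (C *\<^sub>v w) = w" using C w by simp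
    qed (use C w in simp)
    then show ?thesis using B by (auto simp: row_space_eq[OF B])
  qed
  moreover have "row_space ?B \<subseteq> row_space ?A"
    unfolding row_space_def
  proof (rule span_is_monotone, rule subsetI)
    fix r assume "r \<in> set (rows ?B)"
    then obtain i where "i < ?k" "r = row ?B i" using B by (auto simp: rows_def)
    with rows obtain i' where "i' < card ?X" "r = row ?A i'" by metis
    with A show "r \<in> set (rows ?A)" by (simp add: rows_def)
  qed
  moreover have "row_space ?A \<subseteq> carrier_vec ?k"
    using A by (auto simp: row_space_eq[OF A])
  ultimately have 3: "row_space ?B = row_space ?A" by blast
  have "?X - (?X - S) = S" using S by blast
  then show ?thesis
    using F S 1 2 3 A by (simp add: rooted_forest_def Let_def)
qed

section \<open>Entries of the incidence matrix\<close>

lemma incidence_nonzeroD: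
  assumes "incidence r f \<noteq> 0"
  shows "r \<subseteq> f"
proof (rule ccontr)
  assume "\<not> r \<subseteq> f"
  then have "r \<noteq> f - {x}" for x by blast
  then have "incidence r f = 0" by (simp add: incidence_def)
  with assms show False by simp
qed

text \<open>The vertex missing from \<open>r\<close> occupies exactly one position \<open>k\<close>
  of the sorted list, so a single summand survives and equals a sign.\<close>

lemma incidence_facet_squared:
  assumes fin: "finite f" and rf: "facet r f"
  shows "(incidence r f)\<^sup>2 = 1"
proof -
  let ?xs = "sorted_list_of_set f"
  have "card (f - r) = 1"
    using rf fin card_Diff_subset[of r f] by (auto simp: facet_def finite_subset)
  then obtain x where x: "f - r = {x}" by (rule card_1_singletonE)
  with rf have r: "r = f - {x}" and xf: "x \<in> f" by (auto simp: facet_def)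
  have len: "length ?xs = card f" by simp
  from xf fin obtain k where k: "k < card f" "?xs ! k = x"
    by (metis in_set_conv_nth len set_sorted_list_of_set)
  have eq: "r = f - {?xs ! j} \<longleftrightarrow> j = k" if "j < card f" for j
  proof
    assume rj: "r = f - {?xs ! j}"
    have "?xs ! j \<in> f" using that fin by (metis len nth_mem set_sorted_list_of_set)
    with rj r xf have "?xs ! j = ?xs ! k" using k by blast
    then show "j = k" using that k nth_eq_iff_index_eq[of ?xs j k] by simp
  qed (use r k in simp)
  have "incidence r f = (\<Sum>j<card f. if j = k then (-1) ^ j else 0)"
    unfolding incidence_def by (rule sum.cong) (use eq in auto)
  also have "\<dots> = (-1) ^ k" using k by simp
  finally show ?thesis by (simp add: power_mult[symmetric] mult.commute)
qed


subsection \<open>Acyclic matchings\<close>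

text \<open>
  A matching has no closed gradient path iff its pairs admit a linear extension; the real-valued
  height \<open>h\<close> encodes the latter.
\<close>

definition acyclic_matching :: "'a set set \<Rightarrow> int \<Rightarrow> ('a set \<times> 'a set) set \<Rightarrow> bool" where
  "acyclic_matching K d V \<longleftrightarrow>
     V \<subseteq> cells K (d - 1) \<times> cells K d \<and> (\<forall>x\<in>V. fst x \<subseteq> snd x) \<and>
     inj_on fst V \<and> inj_on snd V \<and>
     (\<exists>h :: 'a set \<Rightarrow> real. \<forall>x\<in>V. \<forall>y\<in>V. x \<noteq> y \<longrightarrow> fst x \<subseteq> snd y \<longrightarrow> h (snd x) < h (snd y))"

lemma acyclic_matching_mono:
  "acyclic_matching L d V \<Longrightarrow> L \<subseteq> K \<Longrightarrow> acyclic_matching K d V"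
  unfolding acyclic_matching_def cells_def by blast

lemma finite_cells: "finite K \<Longrightarrow> finite (cells K p)"
  by (simp add: cells_def)

lemma acyclic_matching_finite:
  assumes "acyclic_matching K d V" and "finite K"
  shows "finite V"
  using assms finite_cells by (metis acyclic_matching_def finite_SigmaI finite_subset)

text \<open>The sum of the heights is invariant under \<open>\<pi>\<close>, while each summand can only decrease.\<close>

lemma acyclic_matching_rigid:
  assumes V: "acyclic_matching K d V" and fin: "finite V" and \<pi>: "bij_betw \<pi> V V"
    and sub: "\<And>x. x \<in> V \<Longrightarrow> fst (\<pi> x) \<subseteq> snd x" and x: "x \<in> V"
  shows "\<pi> x = x"
proof (rule ccontr)
  assume ne: "\<pi> x \<noteq> x"
  obtain h :: "'a set \<Rightarrow> real" where
    h: "\<And>x y. x \<in> V \<Longrightarrow> y \<in> V \<Longrightarrow> x \<noteq> y \<Longrightarrow> fst x \<subseteq> snd y \<Longrightarrow> h (snd x) < h (snd y)"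
    using V unfolding acyclic_matching_def by blast
  have \<pi>V: "\<pi> y \<in> V" if "y \<in> V" for y using \<pi> that by (auto simp: bij_betw_def)
  have "(\<Sum>y\<in>V. h (snd (\<pi> y))) < (\<Sum>y\<in>V. h (snd y))"
  proof (rule sum_strict_mono_ex1[OF fin])
    show "\<forall>y\<in>V. h (snd (\<pi> y)) \<le> h (snd y)"
      using h \<pi>V sub by (metis less_imp_le order_refl)
    show "\<exists>y\<in>V. h (snd (\<pi> y)) < h (snd y)"
      using h \<pi>V sub x ne by blast
  qed
  moreover have "(\<Sum>y\<in>V. h (snd (\<pi> y))) = (\<Sum>y\<in>V. h (snd y))"
    by (rule sum.reindex_bij_betw[OF \<pi>])
  ultimately show False by simp
qed

text \<open>From a pair of \<open>V\<close> pass to the pair of \<open>W\<close> with the same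
  \<open>d\<close>-cell, then to the pair of \<open>V\<close> with the same lower cell. This
  bijection of \<open>V\<close> is the identity by \<open>acyclic_matching_rigid\<close>, so every
  pair of \<open>V\<close> is already a pair of \<open>W\<close>.\<close>

lemma acyclic_matching_unique:
  assumes V: "acyclic_matching K d V" and W: "acyclic_matching K d W" and fin: "finite K"
    and fst: "fst ` V = fst ` W" and snd: "snd ` V = snd ` W"
  shows "V = W"
proof -
  have fV: "finite V" and fW: "finite W"
    using acyclic_matching_finite[OF _ fin] V W by blast+
  have bij: "bij_betw fst V (fst ` V)" "bij_betw snd V (snd ` V)"
    "bij_betw fst W (fst ` V)" "bij_betw snd W (snd ` V)"
    using V W fst snd by (auto simp: acyclic_matching_def bij_betw_def)
  have "V \<subseteq> W"
  proof
    fix x assume x: "x \<in> V"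
    let ?w = "\<lambda>x. inv_into W snd (snd x)" and ?v = "inv_into V fst"
    have w: "?w x \<in> W" "snd (?w x) = snd x" if "x \<in> V" for x
    proof -
      have "snd x \<in> snd ` W" using that snd by blast
      then show "?w x \<in> W" "snd (?w x) = snd x" by (fact inv_into_into f_inv_into_f)+
    qed
    have \<pi>: "fst (?v (fst (?w x))) = fst (?w x)" if "x \<in> V" for x
      using w(1)[OF that] fst by (intro f_inv_into_f) auto
    have "bij_betw (?v \<circ> (fst \<circ> (inv_into W snd \<circ> snd))) V V"
      using bij bij_betw_inv_into by (blast intro: bij_betw_trans)
    then have "(?v \<circ> (fst \<circ> (inv_into W snd \<circ> snd))) x = x"
    proof (rule acyclic_matching_rigid[OF V fV _ _ x])
      fix y assume y: "y \<in> V"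
      show "fst ((?v \<circ> (fst \<circ> (inv_into W snd \<circ> snd))) y) \<subseteq> snd y"
      proof -
        have "fst (?w y) \<subseteq> snd (?w y)" using w(1)[OF y] W unfolding acyclic_matching_def by blast
        then show ?thesis using \<pi>[OF y] w(2)[OF y] by simp
      qed
    qed
    then have "?v (fst (?w x)) = x" by simp
    with \<pi>[OF x] have "fst (?w x) = fst x" by simp
    with w[OF x] show "x \<in> W" by (metis prod.expand)
  qed
  moreover have "card V = card W"
    using bij_betw_same_card[OF bij(1)] bij_betw_same_card[OF bij(3)] by simp
  ultimately show ?thesis using fW by (simp add: card_subset_eq)
qed

text \<open>A permutation with a nonzero Leibniz term moves each lower cell to a face of its
  partner. Transported to \<open>V\<close> it satisfies \<open>acyclic_matching_rigid\<close>, so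
  only the identity term survives, and it is a product of signs.\<close>

lemma minor_acyclic_matching:
  assumes V: "acyclic_matching K d V" and K: "finite K" "\<forall>\<sigma>\<in>K. finite \<sigma>"
  shows "(minor incidence (fst ` V) (\<lambda>\<sigma>. snd (inv_into V fst \<sigma>)))\<^sup>2 = 1"
proof -
  let ?S = "fst ` V" and ?g = "inv_into V fst"
  let ?f = "\<lambda>\<sigma>. snd (?g \<sigma>)"
  have fV: "finite V" using acyclic_matching_finite V K(1) .
  then have fS: "finite ?S" by simp
  have inj: "inj_on fst V" using V by (simp add: acyclic_matching_def)
  have g: "?g \<sigma> \<in> V" "fst (?g \<sigma>) = \<sigma>" if "\<sigma> \<in> ?S" for \<sigma>
    using that by (fact inv_into_into f_inv_into_f)+
  have fin: "finite (snd x)" if "x \<in> V" for x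
    using that V K(2) by (auto simp: acyclic_matching_def cells_def)
  let ?t = "\<lambda>p. real_of_int (sign p) * (\<Prod>\<sigma>\<in>?S. incidence (p \<sigma>) (?f \<sigma>))"
  have "minor incidence ?S ?f = (\<Sum>p | p permutes ?S. ?t p)"
    by (simp add: minor_def perm_det_def)
  also have "\<dots> = (\<Sum>p\<in>{id}. ?t p)"
  proof (rule sum.mono_neutral_right)
    show "finite {p. p permutes ?S}" using fS by (rule finite_permutations)
    show "{id} \<subseteq> {p. p permutes ?S}" by (simp add: permutes_id)
    show "\<forall>p\<in>{p. p permutes ?S} - {id}. ?t p = 0"
    proof (rule ballI, rule ccontr)
      fix p assume p0: "p \<in> {p. p permutes ?S} - {id}" and "?t p \<noteq> 0"
      then have nz: "incidence (p \<sigma>) (?f \<sigma>) \<noteq> 0" if "\<sigma> \<in> ?S" for \<sigma>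
        using that fS by auto
      have p: "p permutes ?S" using p0 by simp
      have pS: "p \<sigma> \<in> ?S" if "\<sigma> \<in> ?S" for \<sigma> using permutes_in_image[OF p] that by blast
      have "bij_betw fst V ?S" using inj by (simp add: bij_betw_def)
      then have bij: "bij_betw (?g \<circ> (p \<circ> fst)) V V"
        using permutes_imp_bij[OF p] bij_betw_inv_into by (blast intro: bij_betw_trans)
      have sub: "fst ((?g \<circ> (p \<circ> fst)) y) \<subseteq> snd y" if y: "y \<in> V" for y
      proof -
        have "p (fst y) \<subseteq> ?f (fst y)"
          using nz[of "fst y"] y by (intro incidence_nonzeroD) auto
        then show ?thesis using y g(2)[OF pS, of "fst y"] inv_into_f_f[OF inj y] by simp
      qed
      have "p \<sigma> = \<sigma>" if \<sigma>: "\<sigma> \<in> ?S" for \<sigma>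
      proof -
        have "(?g \<circ> (p \<circ> fst)) (?g \<sigma>) = ?g \<sigma>"
          by (rule acyclic_matching_rigid[OF V fV bij sub g(1)[OF \<sigma>]])
        then have "?g (p \<sigma>) = ?g \<sigma>" using g(2)[OF \<sigma>] by simp
        then show ?thesis using g(2)[OF \<sigma>] g(2)[OF pS[OF \<sigma>]] by simp
      qed
      then have "p = id" using permutes_not_in[OF p] by (metis eq_id_iff)
      with p0 show False by simp
    qed
  qed
  also have "\<dots> = (\<Prod>\<sigma>\<in>?S. incidence \<sigma> (?f \<sigma>))" by simp
  finally have "(minor incidence ?S ?f)\<^sup>2 = (\<Prod>\<sigma>\<in>?S. (incidence \<sigma> (?f \<sigma>))\<^sup>2)"
    by (simp add: prod_power_distrib)
  also have "\<dots> = 1"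
  proof (rule prod.neutral, rule ballI, rule incidence_facet_squared)
    fix \<sigma> assume \<sigma>: "\<sigma> \<in> ?S"
    show "finite (?f \<sigma>)" using fin g(1)[OF \<sigma>] .
    have "?g \<sigma> \<in> cells K (d - 1) \<times> cells K d" "fst (?g \<sigma>) \<subseteq> snd (?g \<sigma>)"
      using V g(1)[OF \<sigma>] by (auto simp: acyclic_matching_def)
    then show "facet \<sigma> (?f \<sigma>)"
      using g(2)[OF \<sigma>] by (auto simp: facet_def cells_def)
  qed
  finally show ?thesis .
qed

section \<open>Collapses yield acyclic matchings\<close>

text \<open>The removed pairs form the matching. Induction peels off the first collapse and gives
  its pair a height above all later ones; as its lower cell is free, it lies in no later
  \<open>d\<close>-cell, so no inequality in the other direction is required.\<close>

lemma collapse_imp_acyclic_matching: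
  assumes "(elementary_collapse d)\<^sup>*\<^sup>* L L'" and "finite L"
  shows "\<exists>V. acyclic_matching L d V \<and> L' = L - fst ` V - snd ` V"
  using assms
proof (induction rule: converse_rtranclp_induct)
  case base
  show ?case by (rule exI[of _ "{}"]) (auto simp: acyclic_matching_def)
next
  case (step L L1)
  obtain \<sigma> \<tau> where \<tau>: "\<tau> \<in> cells L d" and \<sigma>: "\<sigma> \<in> cells L (d - 1)" and sub: "\<sigma> \<subseteq> \<tau>"
    and free: "\<And>\<rho>. \<rho> \<in> L \<Longrightarrow> \<sigma> \<subset> \<rho> \<Longrightarrow> \<rho> = \<tau>" and L1: "L1 = L - {\<sigma>, \<tau>}"
    using step.hyps(1) unfolding elementary_collapse_def by blast
  obtain V where V: "acyclic_matching L1 d V" and L': "L' = L1 - fst ` V - snd ` V"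
    using step.IH step.prems L1 by auto
  have fV: "finite V" using acyclic_matching_finite[OF V] step.prems L1 by simp
  have VL: "fst x \<in> cells L (d - 1)" "snd x \<in> cells L d"
    "fst x \<noteq> \<sigma>" "snd x \<noteq> \<tau>" "fst x \<subseteq> snd x" if "x \<in> V" for x
  proof -
    have "V \<subseteq> cells L1 (d - 1) \<times> cells L1 d" using V by (simp add: acyclic_matching_def)
    with that have x: "fst x \<in> cells L1 (d - 1)" "snd x \<in> cells L1 d"
      by (metis mem_Times_iff subsetD)+
    have "cells L1 p \<subseteq> cells L p - {\<sigma>, \<tau>}" for p unfolding L1 cells_def by blast
    with x show "fst x \<in> cells L (d - 1)" "snd x \<in> cells L d" "fst x \<noteq> \<sigma>" "snd x \<noteq> \<tau>"
      by blast+
    show "fst x \<subseteq> snd x" using that V unfolding acyclic_matching_def by blast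
  qed
  obtain h :: "'a set \<Rightarrow> real" where
    h: "\<And>x y. x \<in> V \<Longrightarrow> y \<in> V \<Longrightarrow> x \<noteq> y \<Longrightarrow> fst x \<subseteq> snd y \<Longrightarrow> h (snd x) < h (snd y)"
    using V unfolding acyclic_matching_def by blast
  \<comment> \<open>The witness is one more than the maximal height; for empty \<open>V\<close> the
    claim is vacuous.\<close>
  obtain B where B: "h (snd x) < B" if "x \<in> V" for x
  proof
    fix x assume "x \<in> V"
    then have "h (snd x) \<le> Max ((\<lambda>x. h (snd x)) ` V)"
      using fV by (intro Max_ge) auto
    then show "h (snd x) < Max ((\<lambda>x. h (snd x)) ` V) + 1" by simp
  qed
  \<comment> \<open>Freeness of \<open>\<sigma>\<close> would identify such a \<open>d\<close>-cell
    with \<open>\<tau>\<close>, which is already removed.\<close>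
  have nsub: "\<not> \<sigma> \<subseteq> snd x" if x: "x \<in> V" for x
  proof
    assume "\<sigma> \<subseteq> snd x"
    moreover have "\<sigma> \<noteq> snd x" using \<sigma> VL(2)[OF x] by (auto simp: cells_def)
    ultimately have "snd x = \<tau>" using free VL(2)[OF x] by (auto simp: cells_def)
    with VL(4)[OF x] show False by simp
  qed
  let ?V = "insert (\<sigma>, \<tau>) V" and ?h = "h(\<tau> := B)"
  have "acyclic_matching L d ?V"
    unfolding acyclic_matching_def
  proof (intro conjI exI[of _ ?h])
    show "?V \<subseteq> cells L (d - 1) \<times> cells L d"
      using VL(1,2) \<sigma> \<tau> by (auto simp: mem_Times_iff)
    show "\<forall>x\<in>?V. fst x \<subseteq> snd x" using VL(5) sub by auto
    show "inj_on fst ?V" "inj_on snd ?V"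
      using V VL(3,4) by (auto simp: acyclic_matching_def)
    show "\<forall>x\<in>?V. \<forall>y\<in>?V. x \<noteq> y \<longrightarrow> fst x \<subseteq> snd y \<longrightarrow> ?h (snd x) < ?h (snd y)"
      using h B nsub VL(4) by auto
  qed
  moreover have "L' = L - fst ` ?V - snd ` ?V" using L' L1 by auto
  ultimately show ?case by blast
qed

text \<open>Dimension tells the removed cells apart: the \<open>d\<close>-cells present at the start
  are \<open>F\<close>, and none survives; of the \<open>(d - 1)\<close>-cells, exactly those in
  \<open>S\<close> are missing at the end.\<close>

lemma simplicially_collapses_imp_acyclic_matching:
  assumes K: "finite K" and F: "F \<subseteq> cells K d" and S: "S \<subseteq> cells K (d - 1)"
    and collapse: "simplicially_collapses K d F (cells K (d - 1) - S)"
  shows "\<exists>V. acyclic_matching K d V \<and> fst ` V = S \<and> snd ` V = F"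
proof -
  let ?L = "skeleton K (d - 1) \<union> F"
  let ?L' = "skeleton K (d - 2) \<union> (cells K (d - 1) - S)"
  have LK: "?L \<subseteq> K" using F by (auto simp: skeleton_def cells_def)
  then have "finite ?L" using K by (rule finite_subset)
  with collapse_imp_acyclic_matching[of d ?L ?L'] collapse
  obtain V where V: "acyclic_matching ?L d V" and L': "?L' = ?L - fst ` V - snd ` V"
    unfolding simplicially_collapses_def by blast
  have fst_V: "fst ` V \<subseteq> cells K (d - 1)" and snd_V: "snd ` V \<subseteq> F"
  proof -
    have "V \<subseteq> cells ?L (d - 1) \<times> cells ?L d" using V by (simp add: acyclic_matching_def)
    moreover have "cells ?L (d - 1) \<subseteq> cells K (d - 1)" using LK by (auto simp: cells_def)
    moreover have "cells ?L d \<subseteq> F" by (auto simp: cells_def skeleton_def)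
    ultimately show "fst ` V \<subseteq> cells K (d - 1)" "snd ` V \<subseteq> F" by auto
  qed
  have "fst ` V = S"
  proof (intro equalityI subsetI)
    fix \<sigma> assume \<sigma>: "\<sigma> \<in> fst ` V"
    then have "\<sigma> \<notin> ?L'" unfolding L' by blast
    with \<sigma> fst_V show "\<sigma> \<in> S" by blast
  next
    fix \<sigma> assume \<sigma>: "\<sigma> \<in> S"
    then have "\<sigma> \<in> K" "int (card \<sigma>) = d" using S by (auto simp: cells_def)
    then have "\<sigma> \<notin> ?L'" "\<sigma> \<in> ?L" "\<sigma> \<notin> F"
      using \<sigma> F by (auto simp: skeleton_def cells_def)
    with snd_V show "\<sigma> \<in> fst ` V" unfolding L' by blast
  qed
  moreover have "snd ` V = F"
  proof (intro equalityI subsetI)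
    fix \<tau> assume \<tau>: "\<tau> \<in> F"
    then have "int (card \<tau>) = d + 1" using F by (auto simp: cells_def)
    then have "\<tau> \<notin> ?L'" "\<tau> \<notin> cells K (d - 1)"
      by (auto simp: skeleton_def cells_def)
    with fst_V \<tau> show "\<tau> \<in> snd ` V" unfolding L' by blast
  qed (use snd_V in blast)
  ultimately show ?thesis using acyclic_matching_mono[OF V LK] by blast
qed

section \<open>Acyclic matchings as gradients of discrete Morse functions\<close>

text \<open>Criticality in low dimensions confines the gradient to the top two dimensions, the
  bounds on exceptions make it a matching, and \<open>f\<close> itself serves as the height.\<close>

lemma acyclic_matching_gradient:
  assumes K: "finite K" and dim: "K = skeleton K d" and f: "f \<in> morse_functions K"
    and crit: "\<forall>p<d - 1. card (critical_cells K f p) = card (cells K p)"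
  shows "acyclic_matching K d (gradient K f)"
    and "card (critical_cells K f d) + card (gradient K f) = card (cells K d)"
proof -
  let ?V = "gradient K f"
  have fin: "finite (face_exceptions K f \<rho>)" "finite (coface_exceptions K f \<rho>)" for \<rho>
    using K by (auto simp: face_exceptions_def coface_exceptions_def)
  have le1: "x = y" if "x \<in> A" "y \<in> A" "finite A" "card A \<le> 1" for x y :: "'a set" and A
    using that by (auto simp: card_le_Suc0_iff_eq)
  have top: "int (card \<rho>) \<le> d + 1" if "\<rho> \<in> K" for \<rho>
    using that dim by (auto simp: skeleton_def)
  \<comment> \<open>Equal cardinalities force every cell of this dimension to be critical. The empty
    cell is covered, with \<open>?p\<close> equal to -1.\<close>
  have low: "coface_exceptions K f \<rho> = {}" if \<rho>: "\<rho> \<in> K" "int (card \<rho>) < d" for \<rho>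
  proof -
    let ?p = "int (card \<rho>) - 1"
    have "critical_cells K f ?p = cells K ?p"
      using crit \<rho> by (intro card_subset_eq finite_cells[OF K]) (auto simp: critical_cells_def)
    moreover have "\<rho> \<in> cells K ?p" using \<rho> by (simp add: cells_def)
    ultimately show ?thesis by (auto simp: critical_cells_def)
  qed
  have V: "fst x \<in> cells K (d - 1)" "snd x \<in> cells K d" if x: "x \<in> ?V" for x
  proof -
    obtain \<sigma> \<tau> where [simp]: "x = (\<sigma>, \<tau>)" by (cases x)
    have "\<sigma> \<in> K" "\<tau> \<in> K" "card \<tau> = card \<sigma> + 1" "\<tau> \<in> coface_exceptions K f \<sigma>"
      using x by (auto simp: gradient_def facet_def coface_exceptions_def)
    then have "int (card \<sigma>) = d" using low[of \<sigma>] top[of \<tau>] by fastforce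
    with \<open>\<sigma> \<in> K\<close> \<open>\<tau> \<in> K\<close> \<open>card \<tau> = card \<sigma> + 1\<close>
    show "fst x \<in> cells K (d - 1)" "snd x \<in> cells K d" by (auto simp: cells_def)
  qed
  have inj_fst: "inj_on fst ?V"
  proof (rule inj_onI)
    fix x y assume xy: "x \<in> ?V" "y \<in> ?V" "fst x = fst y"
    then have "snd x \<in> coface_exceptions K f (fst x)" "snd y \<in> coface_exceptions K f (fst x)"
      by (auto simp: gradient_def coface_exceptions_def)
    moreover have "fst x \<in> K" using V(1)[OF xy(1)] by (simp add: cells_def)
    then have "card (coface_exceptions K f (fst x)) \<le> 1" using f by (auto simp: morse_functions_def)
    ultimately have "snd x = snd y" using le1 fin by blast
    with xy show "x = y" by (simp add: prod_eq_iff)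
  qed
  have inj_snd: "inj_on snd ?V"
  proof (rule inj_onI)
    fix x y assume xy: "x \<in> ?V" "y \<in> ?V" "snd x = snd y"
    then have "fst x \<in> face_exceptions K f (snd x)" "fst y \<in> face_exceptions K f (snd x)"
      by (auto simp: gradient_def face_exceptions_def)
    moreover have "snd x \<in> K" using V(2)[OF xy(1)] by (simp add: cells_def)
    then have "card (face_exceptions K f (snd x)) \<le> 1" using f by (auto simp: morse_functions_def)
    ultimately have "fst x = fst y" using le1 fin by blast
    with xy show "x = y" by (simp add: prod_eq_iff)
  qed
  show "acyclic_matching K d ?V"
    unfolding acyclic_matching_def
  proof (intro conjI exI[of _ f] ballI impI)
    show "?V \<subseteq> cells K (d - 1) \<times> cells K d" using V by (auto simp: mem_Times_iff)
    show "fst x \<subseteq> snd x" if "x \<in> ?V" for x using that by (auto simp: gradient_def facet_def)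
    fix x y assume xy: "x \<in> ?V" "y \<in> ?V" "x \<noteq> y" "fst x \<subseteq> snd y"
    \<comment> \<open>Such a pair would share a cell with \<open>x\<close> and another with
      \<open>y\<close>, forcing \<open>x = y\<close>. Hence \<open>f\<close> rises strictly from
      \<open>fst x\<close> to \<open>snd y\<close>, while it does not rise from \<open>fst x\<close>
      to \<open>snd x\<close>.\<close>
    have "(fst x, snd y) \<notin> ?V"
      using xy inj_fst inj_snd by (metis fst_conv inj_onD snd_conv)
    then have "f (fst x) < f (snd y)"
      using xy(4) V(1)[OF xy(1)] V(2)[OF xy(2)] by (auto simp: gradient_def facet_def cells_def)
    moreover have "f (snd x) \<le> f (fst x)" using xy(1) by (auto simp: gradient_def)
    ultimately show "f (snd x) < f (snd y)" by simp
  qed (fact inj_fst inj_snd)+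
  \<comment> \<open>Top cells have no cofaces, so being critical means being unmatched.\<close>
  have "critical_cells K f d = cells K d - snd ` ?V"
  proof (intro equalityI subsetI)
    fix \<tau> assume \<tau>: "\<tau> \<in> cells K d - snd ` ?V"
    then have "face_exceptions K f \<tau> = {}"
      by (force simp: face_exceptions_def gradient_def cells_def)
    moreover have "coface_exceptions K f \<tau> = {}"
      using \<tau> top by (fastforce simp: coface_exceptions_def facet_def cells_def)
    ultimately show "\<tau> \<in> critical_cells K f d" using \<tau> by (simp add: critical_cells_def)
  next
    fix \<tau> assume "\<tau> \<in> critical_cells K f d"
    then show "\<tau> \<in> cells K d - snd ` ?V"
      by (auto simp: critical_cells_def gradient_def face_exceptions_def)
  qed
  moreover have sub: "snd ` ?V \<subseteq> cells K d" using V(2) by blast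
  moreover have "card (snd ` ?V) = card ?V" using inj_snd by (rule card_image)
  ultimately show "card (critical_cells K f d) + card ?V = card (cells K d)"
    using finite_cells[OF K, of d] card_mono[OF finite_cells[OF K] sub]
    by (simp add: card_Diff_subset finite_subset)
qed

lemma acyclic_matching_imp_gradient:
  assumes K: "finite K" and dim: "K = skeleton K d" and V: "acyclic_matching K d V"
  shows "\<exists>f\<in>morse_functions K. gradient K f = V \<and>
    (\<forall>p<d - 1. card (critical_cells K f p) = card (cells K p))"
proof -
  have fV: "finite V" using acyclic_matching_finite[OF V K] .
  have inj: "inj_on fst V" "inj_on snd V" using V by (auto simp: acyclic_matching_def)
  have VK: "fst x \<in> K" "snd x \<in> K" "int (card (fst x)) = d" "int (card (snd x)) = d + 1"
    "fst x \<subseteq> snd x" if "x \<in> V" for x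
    using that V by (auto simp: acyclic_matching_def cells_def)
  obtain h :: "'a set \<Rightarrow> real" where
    h: "\<And>x y. x \<in> V \<Longrightarrow> y \<in> V \<Longrightarrow> x \<noteq> y \<Longrightarrow> fst x \<subseteq> snd y \<Longrightarrow> h (snd x) < h (snd y)"
    using V unfolding acyclic_matching_def by blast
  \<comment> \<open>A bound on the absolute heights that is nonnegative even for empty
    \<open>V\<close>.\<close>
  define B where "B = (\<Sum>x\<in>V. \<bar>h (snd x)\<bar>)"
  have B: "\<bar>h (snd x)\<bar> \<le> B" if "x \<in> V" for x
    unfolding B_def using fV that by (intro member_le_sum) auto
  \<comment> \<open>Both cells of a pair get the same value, which already counts as an exception.
    The shift places these values between \<open>d + 1\<close> and \<open>2 * B + d + 1\<close>:
    above the unmatched lower cells, whose values are at most \<open>d\<close>, and below the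
    unmatched top cells.\<close>
  define f where "f = (\<lambda>\<rho>\<in>K.
    if \<rho> \<in> fst ` V then h (snd (inv_into V fst \<rho>)) + B + d + 1
    else if \<rho> \<in> snd ` V then h \<rho> + B + d + 1
    else if int (card \<rho>) = d + 1 then 2 * B + d + 2
    else real (card \<rho>))"
  have f_fst: "f (fst x) = h (snd x) + B + d + 1" if "x \<in> V" for x
    using that VK[OF that] inv_into_f_f[OF inj(1)] by (simp add: f_def)
  have f_snd: "f (snd x) = h (snd x) + B + d + 1" if x: "x \<in> V" for x
  proof -
    have "snd x \<notin> fst ` V" using VK(3) VK(4)[OF x] by force
    then show ?thesis using x VK[OF x] by (simp add: f_def)
  qed
  have f_top: "f \<rho> = 2 * B + d + 2" if "\<rho> \<in> K" "int (card \<rho>) = d + 1" "\<rho> \<notin> snd ` V" for \<rho>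
  proof -
    have "\<rho> \<notin> fst ` V" using VK(3) that(2) by force
    then show ?thesis using that by (simp add: f_def)
  qed
  have f_low: "f \<rho> = card \<rho>" if "\<rho> \<in> K" "int (card \<rho>) \<le> d" "\<rho> \<notin> fst ` V" for \<rho>
  proof -
    have "\<rho> \<notin> snd ` V" using VK(4) that(2) by force
    then show ?thesis using that by (simp add: f_def)
  qed
  have B0: "0 \<le> B" unfolding B_def by (rule sum_nonneg) simp
  \<comment> \<open>Together with \<open>f_low\<close> this excludes gradient pairs starting at an
    unmatched cell below dimension \<open>d\<close>: its value is its cardinality, and a coface has
    a value at least one larger.\<close>
  have f_ge: "real (card \<rho>) \<le> f \<rho>" if \<rho>: "\<rho> \<in> K" for \<rho>
  proof -
    have "int (card \<rho>) \<le> d + 1" using \<rho> dim by (auto simp: skeleton_def)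
    then have c: "real (card \<rho>) \<le> d + 1" by linarith
    consider "\<rho> \<in> fst ` V" | "\<rho> \<in> snd ` V" | "int (card \<rho>) = d + 1" "\<rho> \<notin> snd ` V"
      | "int (card \<rho>) \<le> d" "\<rho> \<notin> fst ` V"
      using \<open>int (card \<rho>) \<le> d + 1\<close> by linarith
    then show ?thesis
    proof cases
      case 1
      then obtain x where "x \<in> V" "\<rho> = fst x" by blast
      with B[of x] c f_fst[of x] show ?thesis by simp
    next
      case 2
      then obtain x where "x \<in> V" "\<rho> = snd x" by blast
      with B[of x] c f_snd[of x] show ?thesis by simp
    next
      case 3
      with f_top[OF \<rho>] c B0 show ?thesis by simp
    next
      case 4
      with f_low[OF \<rho>] show ?thesis by simp
    qed
  qed
  have gradient: "gradient K f = V"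
  proof (intro equalityI subsetI)
    fix x assume x: "x \<in> V"
    then have "facet (fst x) (snd x)" using VK[OF x] by (simp add: facet_def)
    then show "x \<in> gradient K f"
      using x VK[OF x] f_fst f_snd by (simp add: gradient_def case_prod_unfold)
  next
    fix x assume "x \<in> gradient K f"
    then obtain \<sigma> \<tau> where x: "x = (\<sigma>, \<tau>)" and \<sigma>: "\<sigma> \<in> K" and \<tau>: "\<tau> \<in> K"
      and sub: "\<sigma> \<subseteq> \<tau>" and card: "card \<tau> = card \<sigma> + 1" and le: "f \<tau> \<le> f \<sigma>"
      by (auto simp: gradient_def facet_def)
    have "int (card \<tau>) \<le> d + 1" using \<tau> dim by (auto simp: skeleton_def)
    with card have "int (card \<sigma>) \<le> d" by simp
    with f_low[OF \<sigma>] f_ge[OF \<tau>] le card obtain y where y: "y \<in> V" "\<sigma> = fst y" by fastforce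
    with VK(3)[OF y(1)] card have d: "int (card \<tau>) = d + 1" by simp
    have "\<tau> \<in> snd ` V"
    proof (rule ccontr)
      assume "\<tau> \<notin> snd ` V"
      with f_top[OF \<tau> d] f_fst[OF y(1)] B[OF y(1)] le y(2) show False by simp
    qed
    then obtain z where z: "z \<in> V" "\<tau> = snd z" by blast
    \<comment> \<open>For distinct pairs, acyclicity would make the value at \<open>\<tau>\<close>
      strictly larger than that at \<open>\<sigma>\<close>.\<close>
    have "y = z"
    proof (rule ccontr)
      assume "y \<noteq> z"
      with h y z sub have "h (snd y) < h (snd z)" by blast
      with f_fst[OF y(1)] f_snd[OF z(1)] le y z show False by simp
    qed
    with x y z show "x \<in> V" by simp
  qed
  have face: "face_exceptions K f \<rho> = {\<sigma>. (\<sigma>, \<rho>) \<in> V}"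
    and coface: "coface_exceptions K f \<rho> = {\<tau>. (\<rho>, \<tau>) \<in> V}" if "\<rho> \<in> K" for \<rho>
    using that unfolding gradient[symmetric]
    by (auto simp: face_exceptions_def coface_exceptions_def gradient_def)
  have le1: "card A \<le> 1" if "\<And>x y. x \<in> A \<Longrightarrow> y \<in> A \<Longrightarrow> x = y" for A :: "'a set set"
  proof (cases "A = {}")
    case False
    then obtain x where "x \<in> A" by blast
    with that have "A = {x}" by blast
    then show ?thesis by simp
  qed simp
  have "f \<in> morse_functions K"
    unfolding morse_functions_def
  proof (intro CollectI conjI ballI)
    show "f \<in> K \<rightarrow>\<^sub>E UNIV" by (simp add: f_def)
    fix \<rho> assume \<rho>: "\<rho> \<in> K"
    show "card (face_exceptions K f \<rho>) \<le> 1"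
      unfolding face[OF \<rho>] using inj_onD[OF inj(2)] by (intro le1) fastforce
    show "card (coface_exceptions K f \<rho>) \<le> 1"
      unfolding coface[OF \<rho>] using inj_onD[OF inj(1)] by (intro le1) fastforce
  qed
  moreover have "critical_cells K f p = cells K p" if "p < d - 1" for p
  proof -
    have "face_exceptions K f \<rho> = {} \<and> coface_exceptions K f \<rho> = {}" if \<rho>: "\<rho> \<in> cells K p" for \<rho>
    proof -
      have "\<rho> \<in> K" and c: "int (card \<rho>) = p + 1" using \<rho> by (auto simp: cells_def)
      moreover have "(\<sigma>, \<rho>) \<notin> V" "(\<rho>, \<sigma>) \<notin> V" for \<sigma>
        using VK(3)[of "(\<rho>, \<sigma>)"] VK(4)[of "(\<sigma>, \<rho>)"] c \<open>p < d - 1\<close> by auto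
      ultimately show ?thesis using face coface by simp
    qed
    then show ?thesis by (auto simp: critical_cells_def)
  qed
  ultimately show ?thesis using gradient by (intro bexI[of _ f]) auto
qed

text \<open>Classes are fibres of \<open>gradient\<close>, so they are counted by the gradients that
  occur; \<open>i\<close> gradient pairs leave all but \<open>i\<close> of the
  \<open>d\<close>-cells critical. If \<open>i\<close> exceeds the number of \<open>d\<close>-cells,
  both sides are 0.\<close>

lemma card_morse_classes:
  assumes K: "finite K" and dim: "K = skeleton K d"
  shows "card (morse_classes K d (int (card (cells K d)) - int i)) =
    card {V. acyclic_matching K d V \<and> card V = i}"
proof -
  let ?M = "{f \<in> morse_functions K.
    int (card (critical_cells K f d)) = int (card (cells K d)) - int i \<and>
    (\<forall>p<d - 1. card (critical_cells K f p) = card (cells K p))}"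
  let ?c = "\<lambda>V. {f \<in> morse_functions K. gradient K f = V}"
  have image: "gradient K ` ?M = {V. acyclic_matching K d V \<and> card V = i}"
  proof (intro equalityI subsetI)
    fix V assume "V \<in> gradient K ` ?M"
    then show "V \<in> {V. acyclic_matching K d V \<and> card V = i}"
      using acyclic_matching_gradient[OF K dim] by fastforce
  next
    fix V assume V: "V \<in> {V. acyclic_matching K d V \<and> card V = i}"
    with acyclic_matching_imp_gradient[OF K dim] obtain f where f: "f \<in> morse_functions K"
      "gradient K f = V" "\<forall>p<d - 1. card (critical_cells K f p) = card (cells K p)"
      by blast
    with V acyclic_matching_gradient(2)[OF K dim f(1,3)] show "V \<in> gradient K ` ?M"
      by (intro image_eqI[of _ _ f]) auto
  qed
  have "morse_classes K d (int (card (cells K d)) - int i) = ?c ` gradient K ` ?M"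
    unfolding morse_classes_def quotient_def gradient_equiv_def by (auto simp: image_image)
  \<comment> \<open>Fibres over attained gradients are nonempty, hence distinct for distinct
    gradients.\<close>
  moreover have "inj_on ?c (gradient K ` ?M)"
    by (rule inj_onI) blast
  ultimately have "card (morse_classes K d (int (card (cells K d)) - int i)) = card (gradient K ` ?M)"
    by (simp only: card_image)
  then show ?thesis by (simp only: image)
qed


section \<open>Assembling the characteristic polynomial\<close>

theorem theorem4p6:
  fixes K :: "'a::linorder set set" and d m n :: nat and lam :: real
  assumes "simplicial_complex K"
    and "has_dimension K (int d)"
    and "\<And>F R. rooted_forest K (int d) F R \<Longrightarrow> simplicially_collapses K (int d) F R"
    and "m = card (cells K (int d))"
    and "n = card (cells K (int d - 1))"
  shows "det (laplacian K (int d) + lam \<cdot>\<^sub>m 1\<^sub>m n) =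
    (\<Sum>i=0..n. real (card (morse_classes K (int d) (int m - int i))) * lam ^ (n - i))"
proof -
  have K: "finite K" "\<forall>\<sigma>\<in>K. finite \<sigma>"
    using assms(1) by (auto simp: simplicial_complex_def)
  have dim: "K = skeleton K (int d)" using assms(2) by (simp add: has_dimension_def)
  let ?A = "cells K (int d - 1)" and ?C = "cells K (int d)"
  let ?\<V> = "{V. acyclic_matching K (int d) V}"
  let ?\<Phi> = "\<lambda>V. (fst ` V, snd ` V)"
  have A: "finite ?A" and C: "finite ?C" using finite_cells[OF K(1)] by auto
  have sub: "V \<subseteq> ?A \<times> ?C" and inj_fst: "inj_on fst V" if "V \<in> ?\<V>" for V
    using that by (auto simp: acyclic_matching_def)
  have card_V: "card V \<le> n" if V: "V \<in> ?\<V>" for V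
  proof -
    have "card V = card (fst ` V)" using inj_fst[OF V] by (simp add: card_image)
    also have "\<dots> \<le> n" unfolding assms(5) using sub[OF V] by (intro card_mono A) auto
    finally show ?thesis .
  qed
  have "?\<V> \<subseteq> Pow (?A \<times> ?C)" using sub by blast
  then have fin\<V>: "finite ?\<V>" using A C by (meson finite_Pow_iff finite_SigmaI finite_subset)
  have inj\<Phi>: "inj_on ?\<Phi> ?\<V>"
    using acyclic_matching_unique[OF _ _ K(1)] by (auto intro!: inj_onI)
  have "det (laplacian K (int d) + lam \<cdot>\<^sub>m 1\<^sub>m n) =
      perm_det ?A (\<lambda>i j. (\<Sum>k\<in>?C. incidence i k * incidence j k) + (if i = j then lam else 0))"
    unfolding assms(5) by (rule det_laplacian_plus_scalar[OF A C])
  also have "\<dots> = (\<Sum>S\<in>Pow ?A. \<Sum>F\<in>Pow ?C. lam ^ (n - card S) *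
       (\<Sum>f | f \<in> S \<rightarrow>\<^sub>E F \<and> bij_betw f S F. (\<Prod>i\<in>S. incidence i (f i)) * minor incidence S f))"
    unfolding assms(5) by (rule perm_det_gram_plus_scalar[OF A C])
  \<comment> \<open>Each inner sum is a squared minor, or empty if the sizes differ. It becomes the
    indicator of whether some acyclic matching projects onto \<open>S\<close> and
    \<open>F\<close>.\<close>
  also have "\<dots> = (\<Sum>S\<in>Pow ?A. \<Sum>F\<in>Pow ?C. if (S, F) \<in> ?\<Phi> ` ?\<V> then lam ^ (n - card S) else 0)"
  proof (intro sum.cong refl)
    fix S F assume "S \<in> Pow ?A" "F \<in> Pow ?C"
    then have SF: "S \<subseteq> ?A" "F \<subseteq> ?C" by auto
    then have fin: "finite S" "finite F" using A C by (auto intro: finite_subset)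
    let ?G = "\<Sum>f | f \<in> S \<rightarrow>\<^sub>E F \<and> bij_betw f S F. (\<Prod>i\<in>S. incidence i (f i)) * minor incidence S f"
    have "?G = (if (S, F) \<in> ?\<Phi> ` ?\<V> then 1 else 0)"
    proof (cases "(S, F) \<in> ?\<Phi> ` ?\<V>")
      case True
      then obtain V where V: "acyclic_matching K (int d) V" and S: "S = fst ` V" and F: "F = snd ` V"
        by auto
      have bij: "bij_betw fst V S" "bij_betw snd V F"
        using V S F by (auto simp: acyclic_matching_def bij_betw_def)
      have "bij_betw (snd \<circ> inv_into V fst) S F"
        by (rule bij_betw_trans[OF bij_betw_inv_into[OF bij(1)] bij(2)])
      then have "?G = (minor incidence S (snd \<circ> inv_into V fst))\<^sup>2"
        by (rule sum_bij_minor[OF fin(1)])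
      also have "\<dots> = 1" using minor_acyclic_matching[OF V K] by (simp add: S comp_def)
      finally show ?thesis using True by simp
    next
      case False
      have "?G = 0"
      proof (cases "card S = card F")
        case True
        \<comment> \<open>A nonzero minor would give a rooted forest, whose collapse produces the
          matching assumed not to exist.\<close>
        have "det (incidence_mat S F) = 0"
        proof (rule ccontr)
          assume "det (incidence_mat S F) \<noteq> 0"
          then have "rooted_forest K (int d) F (?A - S)"
            by (rule rooted_forestI[OF A SF(2) fin(2) SF(1) True])
          then have "simplicially_collapses K (int d) F (?A - S)" by (rule assms(3))
          from simplicially_collapses_imp_acyclic_matching[OF K(1) SF(2,1) this] False
          show False by auto
        qed
        then show ?thesis using sum_bij_minor_incidence[OF fin True] by simp
      next
        case False
        then have "{f. f \<in> S \<rightarrow>\<^sub>E F \<and> bij_betw f S F} = {}"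
          using bij_betw_same_card by blast
        then show ?thesis by (simp only: sum.empty)
      qed
      then show ?thesis using False by simp
    qed
    then show "lam ^ (n - card S) * ?G = (if (S, F) \<in> ?\<Phi> ` ?\<V> then lam ^ (n - card S) else 0)"
      by (simp only: mult_1_right mult_zero_right if_distrib[where f = "(*) _"])
  qed
  also have "\<dots> = (\<Sum>(S, F)\<in>Pow ?A \<times> Pow ?C. if (S, F) \<in> ?\<Phi> ` ?\<V> then lam ^ (n - card S) else 0)"
    by (rule sum.cartesian_product)
  also have "\<dots> = (\<Sum>x\<in>?\<Phi> ` ?\<V>. lam ^ (n - card (fst x)))"
  proof (rule sum.mono_neutral_cong_right)
    show "finite (Pow ?A \<times> Pow ?C)" using A C by simp
    show "?\<Phi> ` ?\<V> \<subseteq> Pow ?A \<times> Pow ?C" using sub by fastforce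
  qed (auto split: prod.splits)
  \<comment> \<open>A matching is determined by its two projections, so summing over their pairs is
    summing over matchings.\<close>
  also have "\<dots> = (\<Sum>V\<in>?\<V>. lam ^ (n - card V))"
    using inj_fst by (simp add: sum.reindex[OF inj\<Phi>] card_image)
  \<comment> \<open>By \<open>card_V\<close> every size occurs among the indices \<open>i\<close>,
    so grouping by size loses no matching.\<close>
  also have "\<dots> = (\<Sum>i\<in>{0..n}. \<Sum>V\<in>{V \<in> ?\<V>. card V = i}. lam ^ (n - card V))"
    using card_V by (intro sum.group[symmetric] fin\<V>) auto
  also have "\<dots> = (\<Sum>i=0..n. real (card {V \<in> ?\<V>. card V = i}) * lam ^ (n - i))"
    by simp
  finally show ?thesis
    unfolding assms(4) card_morse_classes[OF K(1) dim] by simp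
qed

end
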